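(* Let $n\ge3$. If an automorphism $T\in\mathbb{T}_n^2$ fixes all corners of the cube $n^2$ and fixes every point of the line $\ell=\{[i,0]: i\in[n]\}$, then $T$ is the identity.
   Context: Let $[n]=\{0,\dots,n-1\}$; the cube $n^2$ is $[n]^2$. A set of $n$ distinct points is a line if it can be ordered $(q^1,\dots,q^n)$ such that in each coordinate the sequence of values is strictly increasing, strictly decreasing or constant, with at least one coordinate non-constant. $\mathbb{T}_n^2$ is the group of permutations of $[n]^2$ mapping lines onto lines. A corner is a point with all coordinates in $\{0,n-1\}$. *)

theory Defs
  imports "HOL-Combinatorics.Permutations"
begin

definition cube2 :: "nat \<Rightarrow> (nat \<times> nat) set" where
  "cube2 n = {..<n} \<times> {..<n}"

definition constant_seq :: "nat \<Rightarrow> (nat \<Rightarrow> nat) \<Rightarrow> bool" where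
  "constant_seq n s \<longleftrightarrow> (\<exists>c. \<forall>k<n. s k = c)"

definition coord_seq :: "nat \<Rightarrow> (nat \<Rightarrow> nat) \<Rightarrow> bool" where
  "coord_seq n s \<longleftrightarrow>
     strict_mono_on {..<n} s \<or> strict_antimono_on {..<n} s \<or> constant_seq n s"

text \<open>The ordering of the points is \<open>q 0, \<dots>, q (n - 1)\<close>; the bijection expresses
  that these are \<open>n\<close> distinct points exhausting \<open>L\<close>.\<close>

definition is_line :: "nat \<Rightarrow> (nat \<times> nat) set \<Rightarrow> bool" where
  "is_line n L \<longleftrightarrow> L \<subseteq> cube2 n \<and>
     (\<exists>q. bij_betw q {..<n} L \<and>
          coord_seq n (\<lambda>k. fst (q k)) \<and> coord_seq n (\<lambda>k. snd (q k)) \<and>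
          \<not> (constant_seq n (\<lambda>k. fst (q k)) \<and> constant_seq n (\<lambda>k. snd (q k))))"

text \<open>Permutations of the cube are represented, via \<open>permutes\<close>, as functions
  that are the identity outside the cube.\<close>

definition line_automorphisms :: "nat \<Rightarrow> (nat \<times> nat \<Rightarrow> nat \<times> nat) set" where
  "line_automorphisms n =
     {T. T permutes cube2 n \<and> (\<forall>L. is_line n L \<longrightarrow> is_line n (T ` L))}"

definition corners :: "nat \<Rightarrow> (nat \<times> nat) set" where
  "corners n = {0, n - 1} \<times> {0, n - 1}"

end

theory Submission
  imports Defs
begin

text \<open>The lines are the rows, the columns and the two diagonals. Each diagonal is the only line
  through its two corners, so \<open>T\<close> preserves both, and the row \<open>\<ell>\<close> is fixed pointwise. The image of
  column \<open>i\<close> passes through \<open>[i,0]\<close>, and by injectivity it is neither a diagonal nor \<open>\<ell>\<close>; hence it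
  is column \<open>i\<close>. Therefore the diagonal points \<open>[j,j]\<close> are fixed, so the image of row \<open>j\<close> passes
  through \<open>[j,j]\<close>; by injectivity it is no column and no diagonal, hence it is row \<open>j\<close>. Every point is
  the intersection of its row and its column.\<close>

section \<open>Explicit rows, columns and diagonals\<close>

definition column_line :: "nat \<Rightarrow> nat \<Rightarrow> (nat \<times> nat) set" where
  "column_line n i = (\<lambda>k. (i, k)) ` {..<n}"

definition row_line :: "nat \<Rightarrow> nat \<Rightarrow> (nat \<times> nat) set" where
  "row_line n j = (\<lambda>k. (k, j)) ` {..<n}"

definition diagonal_line :: "nat \<Rightarrow> (nat \<times> nat) set" where
  "diagonal_line n = (\<lambda>k. (k, k)) ` {..<n}"

definition antidiagonal_line :: "nat \<Rightarrow> (nat \<times> nat) set" where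
  "antidiagonal_line n = (\<lambda>k. (k, n - 1 - k)) ` {..<n}"

lemmas line_defs = column_line_def row_line_def diagonal_line_def antidiagonal_line_def

lemma mem_column_line [simp]: "(a, b) \<in> column_line n i \<longleftrightarrow> a = i \<and> b < n"
  and mem_row_line [simp]: "(a, b) \<in> row_line n j \<longleftrightarrow> b = j \<and> a < n"
  and mem_diagonal_line [simp]: "(a, b) \<in> diagonal_line n \<longleftrightarrow> b = a \<and> a < n"
  and mem_antidiagonal_line [simp]:
    "(a, b) \<in> antidiagonal_line n \<longleftrightarrow> b = n - 1 - a \<and> a < n"
  by (auto simp: line_defs)

lemma card_lines:
  "card (column_line n i) = n" "card (row_line n i) = n"
  "card (diagonal_line n) = n" "card (antidiagonal_line n) = n"
  by (auto simp: line_defs card_image inj_on_def)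

lemma finite_lines:
  "finite (column_line n i)" "finite (row_line n i)"
  "finite (diagonal_line n)" "finite (antidiagonal_line n)"
  by (auto simp: line_defs)

section \<open>Monotone sequences with values below \<open>n\<close>\<close>

text \<open>The sequence grows by at least 1 at each step. Counting up from index 0 gives
  \<open>k \<le> s k\<close>; counting down from \<open>s (n - 1) \<le> n - 1\<close> gives
  \<open>s k \<le> k\<close>.\<close>

lemma strict_mono_on_lessThan_bounded_eq:
  fixes s :: "nat \<Rightarrow> nat"
  assumes mono: "strict_mono_on {..<n} s" and bound: "\<And>k. k < n \<Longrightarrow> s k < n" and k: "k < n"
  shows "s k = k"
proof (rule antisym)
  have step: "s i < s (Suc i)" if "Suc i < n" for i
    using that by (intro strict_mono_onD[OF mono]) auto
  have "i \<le> s i" if "i < n" for i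
    using that
  proof (induction i)
    case (Suc i)
    then show ?case using step[of i] by simp
  qed simp
  then show "k \<le> s k" using k .
  \<comment> \<open>Downward induction: \<open>m\<close> is the distance from the last index
    \<open>n - 1\<close>.\<close>
  have "s (n - 1 - m) \<le> n - 1 - m" if "m < n" for m
    using that
  proof (induction m)
    case 0
    then show ?case using bound[of "n - 1"] by simp
  next
    case (Suc m)
    then have "Suc (n - 1 - Suc m) = n - 1 - m" by simp
    then show ?case using Suc step[of "n - 1 - Suc m"] by simp
  qed
  from this[of "n - 1 - k"] show "s k \<le> k" using k by simp
qed

text \<open>Reflecting the values by \<open>n - 1 - s k\<close> reduces this to the increasing
  case.\<close>

lemma strict_antimono_on_lessThan_bounded_eq:
  fixes s :: "nat \<Rightarrow> nat"
  assumes anti: "strict_antimono_on {..<n} s" and bound: "\<And>k. k < n \<Longrightarrow> s k < n" and k: "k < n"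
  shows "s k = n - 1 - k"
proof -
  have "strict_mono_on {..<n} (\<lambda>k. n - 1 - s k)"
  proof (rule strict_mono_onI)
    fix r t assume rt: "r \<in> {..<n}" "t \<in> {..<n}" "r < t"
    then have "s t < s r" using anti by (auto simp: monotone_on_def)
    \<comment> \<open>Truncated subtraction stays strict here because
      \<open>s t < s r \<le> n - 1\<close>.\<close>
    then show "n - 1 - s r < n - 1 - s t" using bound[of r] rt by simp
  qed
  from strict_mono_on_lessThan_bounded_eq[OF this _ k] have "n - 1 - s k = k"
    using k by simp
  then show ?thesis using bound[OF k] by simp
qed

lemma coord_seq_cases:
  assumes "coord_seq n s" "\<And>k. k < n \<Longrightarrow> s k < n"
  shows "(\<forall>k<n. s k = k) \<or> (\<forall>k<n. s k = n - 1 - k) \<or> constant_seq n s"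
  using assms strict_mono_on_lessThan_bounded_eq[of n s]
    strict_antimono_on_lessThan_bounded_eq[of n s]
  unfolding coord_seq_def by blast

section \<open>Classification of the lines\<close>

text \<open>Each coordinate is the identity, the reversal or constant. A constant coordinate gives a
  column or a row; otherwise equal directions give the diagonal and opposite ones the
  antidiagonal.\<close>

lemma is_line_cases:
  assumes "is_line n L"
  shows "(\<exists>i. L = column_line n i) \<or> (\<exists>j. L = row_line n j)
    \<or> L = diagonal_line n \<or> L = antidiagonal_line n"
proof -
  from assms obtain q where LC: "L \<subseteq> cube2 n" and bij: "bij_betw q {..<n} L"
    and seqs: "coord_seq n (\<lambda>k. fst (q k))" "coord_seq n (\<lambda>k. snd (q k))"
    unfolding is_line_def by blast
  have L: "L = q ` {..<n}" and card: "card L = n"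
    using bij bij_betw_same_card[OF bij] by (auto simp: bij_betw_def)
  have bounds: "fst (q k) < n" "snd (q k) < n" if "k < n" for k
    using that LC L by (auto simp: cube2_def mem_Times_iff)
  \<comment> \<open>Both sets have \<open>n\<close> elements, so inclusion in a candidate already
    gives equality.\<close>
  have eqI: "L = M" if "\<And>k. k < n \<Longrightarrow> (fst (q k), snd (q k)) \<in> M" "finite M" "card M = n" for M
    using that card by (intro card_subset_eq) (auto simp: L)
  have 1: ?thesis if "constant_seq n (\<lambda>k. fst (q k))"
  proof -
    from that obtain c where "\<And>k. k < n \<Longrightarrow> fst (q k) = c" by (auto simp: constant_seq_def)
    then have "L = column_line n c" using bounds by (intro eqI) (auto simp: finite_lines card_lines)
    then show ?thesis by blast
  qed
  have 2: ?thesis if "constant_seq n (\<lambda>k. snd (q k))"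
  proof -
    from that obtain c where "\<And>k. k < n \<Longrightarrow> snd (q k) = c" by (auto simp: constant_seq_def)
    then have "L = row_line n c" using bounds by (intro eqI) (auto simp: finite_lines card_lines)
    then show ?thesis by blast
  qed
  have 3: ?thesis if "\<forall>k<n. snd (q k) = fst (q k)"
  proof -
    have "L = diagonal_line n"
      using that bounds by (intro eqI) (auto simp: finite_lines card_lines)
    then show ?thesis by blast
  qed
  have 4: ?thesis if "\<forall>k<n. snd (q k) = n - 1 - fst (q k)"
  proof -
    have "L = antidiagonal_line n"
      using that bounds by (intro eqI) (auto simp: finite_lines card_lines)
    then show ?thesis by blast
  qed
  have "(\<forall>k<n. fst (q k) = k) \<or> (\<forall>k<n. fst (q k) = n - 1 - k)
      \<or> constant_seq n (\<lambda>k. fst (q k))"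
    using seqs(1) bounds(1) by (rule coord_seq_cases)
  moreover have "(\<forall>k<n. snd (q k) = k) \<or> (\<forall>k<n. snd (q k) = n - 1 - k)
      \<or> constant_seq n (\<lambda>k. snd (q k))"
    using seqs(2) bounds(2) by (rule coord_seq_cases)
  ultimately show ?thesis
  proof (elim disjE)
    assume "\<forall>k<n. fst (q k) = k" "\<forall>k<n. snd (q k) = k"
    then show ?thesis by (intro 3) auto
  next
    assume "\<forall>k<n. fst (q k) = k" "\<forall>k<n. snd (q k) = n - 1 - k"
    then show ?thesis by (intro 4) auto
  next
    assume "\<forall>k<n. fst (q k) = n - 1 - k" "\<forall>k<n. snd (q k) = k"
    then show ?thesis by (intro 4) auto
  next
    assume "\<forall>k<n. fst (q k) = n - 1 - k" "\<forall>k<n. snd (q k) = n - 1 - k"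
    then show ?thesis by (intro 3) auto
  \<comment> \<open>The five remaining combinations have a constant coordinate.\<close>
  qed (erule 1 | erule 2)+
qed

lemma line_through_cases:
  assumes "is_line n L" "(a, b) \<in> L"
  shows "L = column_line n a \<or> L = row_line n b \<or> L = diagonal_line n \<or> L = antidiagonal_line n"
  using is_line_cases[OF assms(1)] assms(2) by auto

text \<open>Since \<open>0 \<noteq> n - 1\<close>, column 0 and row 0 miss the opposite corner, and
  the antidiagonal misses the origin.\<close>

lemma line_through_corners_eq_diagonal:
  assumes "is_line n L" "n \<ge> 2" "(0, 0) \<in> L" "(n - 1, n - 1) \<in> L"
  shows "L = diagonal_line n"
  using line_through_cases[OF assms(1,3)] assms(2,4) by auto

lemma line_through_corners_eq_antidiagonal:
  assumes "is_line n L" "n \<ge> 2" "(0, n - 1) \<in> L" "(n - 1, 0) \<in> L"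
  shows "L = antidiagonal_line n"
  using line_through_cases[OF assms(1,3)] assms(2,4) by auto

section \<open>The four shapes are lines\<close>

lemma coord_seq_basic:
  "coord_seq n (\<lambda>k. k)" "coord_seq n (\<lambda>k. n - 1 - k)" "coord_seq n (\<lambda>k. c)"
  by (auto simp: coord_seq_def constant_seq_def monotone_on_def)

lemma not_constant_seq_ident:
  assumes "n \<ge> 2"
  shows "\<not> constant_seq n (\<lambda>k. k)"
proof
  assume "constant_seq n (\<lambda>k. k)"
  then obtain c where "\<And>k. k < n \<Longrightarrow> k = c" by (auto simp: constant_seq_def)
  from this[of 0] this[of 1] show False using assms by simp
qed

lemma is_line_column_line: "n \<ge> 2 \<Longrightarrow> i < n \<Longrightarrow> is_line n (column_line n i)"
  unfolding is_line_def
  by (intro conjI exI[of _ "\<lambda>k. (i, k)"])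
    (auto simp: column_line_def cube2_def bij_betw_def inj_on_def coord_seq_basic
      not_constant_seq_ident)

lemma is_line_row_line: "n \<ge> 2 \<Longrightarrow> j < n \<Longrightarrow> is_line n (row_line n j)"
  unfolding is_line_def
  by (intro conjI exI[of _ "\<lambda>k. (k, j)"])
    (auto simp: row_line_def cube2_def bij_betw_def inj_on_def coord_seq_basic
      not_constant_seq_ident)

lemma is_line_diagonal_line: "n \<ge> 2 \<Longrightarrow> is_line n (diagonal_line n)"
  unfolding is_line_def
  by (intro conjI exI[of _ "\<lambda>k. (k, k)"])
    (auto simp: diagonal_line_def cube2_def bij_betw_def inj_on_def coord_seq_basic
      not_constant_seq_ident)

lemma is_line_antidiagonal_line: "n \<ge> 2 \<Longrightarrow> is_line n (antidiagonal_line n)"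
  unfolding is_line_def
  by (intro conjI exI[of _ "\<lambda>k. (k, n - 1 - k)"])
    (use coord_seq_basic(2)[of n] in \<open>auto simp: antidiagonal_line_def cube2_def bij_betw_def
      inj_on_def coord_seq_basic not_constant_seq_ident\<close>)

theorem theorem5:
  fixes n :: nat and T :: "nat \<times> nat \<Rightarrow> nat \<times> nat"
  assumes "n \<ge> 3"
    and "T \<in> line_automorphisms n"
    and "\<forall>p\<in>corners n. T p = p"
    and "\<forall>p\<in>{(i, 0) | i. i < n}. T p = p"
  shows "T = id"
proof -
  have n: "n \<ge> 2" using assms(1) by simp
  have perm: "T permutes cube2 n" and lines: "\<And>L. is_line n L \<Longrightarrow> is_line n (T ` L)"
    using assms(2) by (auto simp: line_automorphisms_def)
  \<comment> \<open>A line equal to its own image is the image of no other line. This excludes the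
    competing candidates below.\<close>
  have inj: "T ` A = T ` B \<longleftrightarrow> A = B" for A B
    using permutes_inj[OF perm] by (rule inj_image_eq_iff)
  have image_mem: "p \<in> T ` L" if "p \<in> L" "T p = p" for p L
    using that by force
  have corner: "T (a, b) = (a, b)" if "a \<in> {0, n - 1}" "b \<in> {0, n - 1}" for a b
    using assms(3) that by (auto simp: corners_def)

  have diag: "T ` diagonal_line n = diagonal_line n"
  proof -
    have "(0, 0) \<in> T ` diagonal_line n" "(n - 1, n - 1) \<in> T ` diagonal_line n"
      using n by (auto intro!: image_mem corner)
    then show ?thesis
      using line_through_corners_eq_diagonal[OF lines[OF is_line_diagonal_line[OF n]] n] by blast
  qed
  have anti: "T ` antidiagonal_line n = antidiagonal_line n"
  proof -
    have "(0, n - 1) \<in> T ` antidiagonal_line n" "(n - 1, 0) \<in> T ` antidiagonal_line n"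
      using n by (auto intro!: image_mem corner)
    then show ?thesis
      using line_through_corners_eq_antidiagonal[OF lines[OF is_line_antidiagonal_line[OF n]] n] by blast
  qed
  have bottom: "T ` row_line n 0 = row_line n 0"
  proof -
    have "T p = p" if "p \<in> row_line n 0" for p
      using assms(4) that by (auto simp: row_line_def)
    then show ?thesis by simp
  qed

  have column: "T ` column_line n i = column_line n i" if i: "i < n" for i
  proof -
    have mem: "(i, 0) \<in> T ` column_line n i"
      using i assms(4) by (intro image_mem) auto
    \<comment> \<open>On row 0 and on both diagonals the first coordinate determines the second, so
      none of them contains both points.\<close>
    have two: "(i, 0) \<in> column_line n i" "(i, 1) \<in> column_line n i"
      using n by auto
    have "column_line n i \<noteq> row_line n 0"
      using two(2) by (metis mem_row_line zero_neq_one)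
    then have "T ` column_line n i \<noteq> row_line n 0" using inj bottom by metis
    moreover have "column_line n i \<noteq> diagonal_line n"
      using two by (metis mem_diagonal_line zero_neq_one)
    then have "T ` column_line n i \<noteq> diagonal_line n" using inj diag by metis
    moreover have "column_line n i \<noteq> antidiagonal_line n"
      using two by (metis mem_antidiagonal_line zero_neq_one)
    then have "T ` column_line n i \<noteq> antidiagonal_line n" using inj anti by metis
    ultimately show ?thesis
      using line_through_cases[OF lines[OF is_line_column_line[OF n i]] mem] by blast
  qed

  have diag_point: "T (j, j) = (j, j)" if j: "j < n" for j
  proof -
    \<comment> \<open>Both lines are preserved, and they meet only in \<open>(j, j)\<close>.\<close>
    have "T (j, j) \<in> diagonal_line n" "T (j, j) \<in> column_line n j"
      using diag column[OF j] j by (metis imageI mem_diagonal_line, metis imageI mem_column_line)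
    then show ?thesis by (cases "T (j, j)") auto
  qed

  have row: "T ` row_line n j = row_line n j" if j: "j < n" for j
  proof -
    have mem: "(j, j) \<in> T ` row_line n j"
      using j diag_point by (intro image_mem) auto
    have two: "(0, j) \<in> row_line n j" "(1, j) \<in> row_line n j"
      using n by auto
    have "row_line n j \<noteq> column_line n i" for i
      using two by (metis mem_column_line zero_neq_one)
    then have "T ` row_line n j \<noteq> column_line n j" using inj column[OF j] by metis
    moreover have "row_line n j \<noteq> diagonal_line n"
      using two by (metis mem_diagonal_line zero_neq_one)
    then have "T ` row_line n j \<noteq> diagonal_line n" using inj diag by metis
    moreover have "row_line n j \<noteq> antidiagonal_line n"
    proof
      assume "row_line n j = antidiagonal_line n"
      \<comment> \<open>The antidiagonal has different heights above 0 and 1: for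
        \<open>n \<ge> 2\<close> the subtraction is not truncated.\<close>
      with two have "j = n - 1 - 0" "j = n - 1 - 1" by (metis mem_antidiagonal_line)+
      with n show False by simp
    qed
    then have "T ` row_line n j \<noteq> antidiagonal_line n" using inj anti by metis
    ultimately show ?thesis
      using line_through_cases[OF lines[OF is_line_row_line[OF n j]] mem] by blast
  qed

  show ?thesis
  proof
    fix p :: "nat \<times> nat"
    obtain i j where p: "p = (i, j)" by (cases p)
    show "T p = id p"
    proof (cases "p \<in> cube2 n")
      case True
      then have ij: "i < n" "j < n" by (auto simp: p cube2_def)
      then have "T p \<in> column_line n i" "T p \<in> row_line n j"
        unfolding p using column row
        by (metis imageI mem_column_line, metis imageI mem_row_line)
      then show ?thesis by (cases "T p") (auto simp: p)
    next
      case False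
      \<comment> \<open>Equality with \<open>id\<close> also covers points outside the cube, which
        \<open>permutes\<close> leaves fixed.\<close>
      then show ?thesis using permutes_not_in[OF perm] by simp
    qed
  qed
qed

end
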